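(* Let $\mathbf{R}=R_0R_1R_2\cdots$ be the Rudin--Shapiro word over $\{1,-1\}$, defined by $R_n=(-1)^{r(n)}$, where $r(n)$ is the number of (possibly overlapping) occurrences of the block $11$ in the binary expansion of $n$. Then $\mathbf{Rdio}(\mathbf{R})\le 25$.
   Context: For an infinite word $\mathbf{a}=a_0a_1a_2\cdots$ and integers $0\le r\le s$, $\mathbf{a}[r,s]$ denotes the finite word $a_ra_{r+1}\cdots a_s$. $(\epsilon,\delta)$-closeness: for two finite words $U=u_1\cdots u_L$ and $V=v_1\cdots v_L$ of the same length $L>0$, a real $\epsilon>0$ and an integer $\delta\ge 0$, $U$ and $V$ are $(\epsilon,\delta)$-close if there exist $\delta$ (possibly empty) subintervals $I_1,\dots,I_\delta$ of $\{1,\dots,L\}$ such that $\{1\le i\le L: u_i\ne v_i\}\subseteq \bigcup_{j=1}^{\delta} I_j$ and $\left|\bigcup_{j=1}^{\delta} I_j\right|\le \epsilon L$. Refined Diophantine exponent: for a real $\rho\ge 1$, $\mathbf{a}$ satisfies Condition $( * )_\rho$ if for every $\epsilon>0$ there exist three sequences of integers $(r_n)_{n\ge0}$, $(s_n)_{n\ge0}$, $(t_n)_{n\ge0}$ and an integer $\delta\ge0$ such that: $-1\le r_n<s_n<t_n$ for all $n$; $t_n\ge\rho s_n$ for all $n$; $s_n-r_n\to\infty$ as $n\to\infty$; and for all $n$ large enough, $\mathbf{a}[r_n+1,r_n+t_n-s_n]$ and $\mathbf{a}[s_n+1,t_n]$ are $(\epsilon,\delta)$-close. The refined Diophantine exponent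 $\mathbf{Rdio}(\mathbf{a})\in[1,\infty]$ is the supremum of the $\rho$ for which $\mathbf{a}$ satisfies $( * )_\rho$. *)

theory Defs
  imports "HOL-Library.Extended_Real"
begin

definition factor :: "(nat \<Rightarrow> 'a) \<Rightarrow> int \<Rightarrow> int \<Rightarrow> 'a list" where
  "factor a r s = map (\<lambda>i. a (nat i)) [r..s]"

text \<open>
  Positions in finite words are numbered from 1, so that letter \<open>i\<close> of \<open>U\<close> is \<open>U ! (i - 1)\<close>.
  The \<open>j\<close>-th interval is \<open>{lo j..hi j}\<close>, which is empty when \<open>hi j < lo j\<close>.
\<close>

definition close_words :: "real \<Rightarrow> nat \<Rightarrow> 'a list \<Rightarrow> 'a list \<Rightarrow> bool" where
  "close_words \<epsilon> \<delta> U V \<longleftrightarrow>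
     length U = length V \<and> 0 < length U \<and>
     (\<exists>lo hi :: nat \<Rightarrow> nat.
        (\<forall>j<\<delta>. {lo j..hi j} \<subseteq> {1..length U}) \<and>
        {i \<in> {1..length U}. U ! (i - 1) \<noteq> V ! (i - 1)} \<subseteq> (\<Union>j<\<delta>. {lo j..hi j}) \<and>
        real (card (\<Union>j<\<delta>. {lo j..hi j})) \<le> \<epsilon> * real (length U))"

definition star_condition :: "(nat \<Rightarrow> 'a) \<Rightarrow> real \<Rightarrow> bool" where
  "star_condition a \<rho> \<longleftrightarrow>
     (\<forall>\<epsilon>>0. \<exists>(r :: nat \<Rightarrow> int) (s :: nat \<Rightarrow> int) (t :: nat \<Rightarrow> int) (\<delta> :: nat).
        (\<forall>n. -1 \<le> r n \<and> r n < s n \<and> s n < t n) \<and>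
        (\<forall>n. real_of_int (t n) \<ge> \<rho> * real_of_int (s n)) \<and>
        filterlim (\<lambda>n. s n - r n) at_top sequentially \<and>
        (\<forall>\<^sub>F n in sequentially.
           close_words \<epsilon> \<delta> (factor a (r n + 1) (r n + t n - s n)) (factor a (s n + 1) (t n))))"

text \<open>
  For a word over a finite alphabet the set below contains 1 (some letter occurs infinitely
  often; compare factors of length 1), so the supremum lies in $[1,\infty]$.
\<close>

definition Rdio :: "(nat \<Rightarrow> 'a) \<Rightarrow> ereal" where
  "Rdio a = (SUP \<rho> \<in> {\<rho>. 1 \<le> \<rho> \<and> star_condition a \<rho>}. ereal \<rho>)"

text \<open>An occurrence of the block 11 is given by the position of its lower-order digit.\<close>

definition count_11 :: "nat \<Rightarrow> nat" where
  "count_11 n = card {i. bit n i \<and> bit n (Suc i)}"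

definition rudin_shapiro :: "nat \<Rightarrow> int" where
  "rudin_shapiro n = (-1) ^ count_11 n"

end

theory Submission
  imports Defs
begin

text \<open>
  Let \<open>p = s - r\<close> and let \<open>q\<close> be the power of two with \<open>p \<le> q < 2 p\<close>. Adding \<open>2 q\<close> to
  \<open>n \<in> 4 i q + [0, 2 q)\<close> multiplies \<open>R n\<close> by \<open>(-1) ^ i\<close> on the first quarter of the block and by
  \<open>- (-1) ^ i\<close> on the second. Hence, if \<open>n\<close> lies in the first quarter and \<open>n + p\<close> in the second, the
  product \<open>R n * R (n + p)\<close> changes its sign under \<open>n \<mapsto> n + 2 q\<close>, so exactly one of \<open>n\<close> and
  \<open>n + 2 q\<close> is a mismatch between the word and its shift by \<open>p\<close>. There are \<open>p\<close> such \<open>n\<close> in each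
  block of length \<open>4 q < 8 p\<close>, so mismatches have positive density in every window of length at
  least \<open>8 q\<close>. If \<open>\<rho> > 25\<close>, the window length \<open>t - s\<close> is at least \<open>24 s\<close>, which exceeds \<open>8 q\<close>, and
  the density bound contradicts closeness for small \<open>\<epsilon>\<close>.
\<close>

section \<open>Binary recurrences and the effect of adding a power of two\<close>

lemma finite_count_11_set: "finite {i. bit (n::nat) i \<and> bit n (Suc i)}"
proof (rule finite_subset)
  show "{i. bit n i \<and> bit n (Suc i)} \<subseteq> {..<n}"
  proof
    fix i assume "i \<in> {i. bit n i \<and> bit n (Suc i)}"
    then have "odd (n div 2 ^ i)" by (simp add: bit_iff_odd)
    then have "2 ^ i \<le> n" by (metis div_less even_zero not_le)
    then show "i \<in> {..<n}" using less_le_trans[OF less_exp] by simp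
  qed
qed simp

lemma count_11_double: "count_11 (2 * n) = count_11 n"
proof -
  have "{i. bit (2 * n) i \<and> bit (2 * n) (Suc i)} = Suc ` {i. bit n i \<and> bit n (Suc i)}"
    (is "?A = Suc ` ?B")
  proof (intro set_eqI)
    fix i show "i \<in> ?A \<longleftrightarrow> i \<in> Suc ` ?B"
      by (cases i) (auto simp: bit_Suc bit_0)
  qed
  then show ?thesis by (simp add: count_11_def card_image)
qed

text \<open>Appending a low digit 1 moves every occurrence up by one place and creates a new one at
  place 0 exactly when the old lowest digit is 1.\<close>

lemma count_11_double_Suc:
  "count_11 (Suc (2 * n)) = count_11 n + (if odd n then 1 else 0)"
proof -
  have "{i. bit (Suc (2 * n)) i \<and> bit (Suc (2 * n)) (Suc i)} =
      (if odd n then {0} else {}) \<union> Suc ` {i. bit n i \<and> bit n (Suc i)}"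
    (is "?A = ?C \<union> Suc ` ?B")
  proof (intro set_eqI)
    fix i show "i \<in> ?A \<longleftrightarrow> i \<in> ?C \<union> Suc ` ?B"
      by (cases i) (auto simp: bit_Suc bit_0)
  qed
  then show ?thesis
    using finite_count_11_set[of n] by (simp add: count_11_def card_image)
qed

lemma rudin_shapiro_double: "rudin_shapiro (2 * n) = rudin_shapiro n"
  by (simp add: rudin_shapiro_def count_11_double)

lemma rudin_shapiro_double_Suc:
  "rudin_shapiro (Suc (2 * n)) = (-1) ^ n * rudin_shapiro n"
  by (simp add: rudin_shapiro_def count_11_double_Suc)

lemma rudin_shapiro_nonzero: "rudin_shapiro n \<noteq> 0"
  by (simp add: rudin_shapiro_def)

text \<open>The hypothesis says that digit \<open>k + 1\<close> of \<open>x\<close> is 0, so the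
  addition only turns this digit into 1. The new occurrences of 11 come from its neighbours, digits
  \<open>k + 2\<close> and \<open>k\<close>, whose parities are those of the two quotients in the
  exponent. The induction strips the lowest digit.\<close>

lemma rudin_shapiro_half_block_shift:
  "even (x div (2 * 2 ^ k)) \<Longrightarrow>
    rudin_shapiro (x + 2 * 2 ^ k) = (-1) ^ (x div (4 * 2 ^ k) + x div 2 ^ k) * rudin_shapiro x"
proof (induction k arbitrary: x)
  case 0
  define i where "i = x div 4"
  have "even (x div 2)" using 0 by simp
  then have "x = 2 * (2 * i) \<or> x = Suc (2 * (2 * i))"
    unfolding i_def by presburger
  then consider "x = 2 * (2 * i)" | "x = Suc (2 * (2 * i))" by blast
  then show ?case
  proof cases
    case 1
    then have "x + 2 = 2 * Suc (2 * i)" by simp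
    then have "rudin_shapiro (x + 2) = (-1) ^ i * rudin_shapiro i"
      by (simp only: rudin_shapiro_double rudin_shapiro_double_Suc)
    moreover have "rudin_shapiro x = rudin_shapiro i"
      by (simp only: 1 rudin_shapiro_double)
    ultimately show ?thesis using 1 by (simp add: minus_one_power_iff)
  next
    case 2
    then have "x + 2 = Suc (2 * Suc (2 * i))" by simp
    then have "rudin_shapiro (x + 2) = - ((-1) ^ i * rudin_shapiro i)"
      by (simp only: rudin_shapiro_double_Suc) simp
    moreover have "rudin_shapiro x = rudin_shapiro i"
      by (simp only: 2 rudin_shapiro_double rudin_shapiro_double_Suc) simp
    moreover have "x div 4 = i" using 2 by (simp add: i_def)
    ultimately show ?thesis using 2 by (simp add: minus_one_power_iff)
  qed
next
  case (Suc k)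
  define y where "y = x div 2"
  have d: "x div (c * 2 ^ Suc k) = y div (c * 2 ^ k)" for c
    by (simp add: y_def div_mult2_eq[symmetric] mult.left_commute)
  have IH: "rudin_shapiro (y + 2 * 2 ^ k) =
      (-1) ^ (x div (4 * 2 ^ Suc k) + x div 2 ^ Suc k) * rudin_shapiro y"
    using Suc.IH[of y] Suc.prems d[of 1] d[of 2] d[of 4] by simp
  have "x = 2 * y \<or> x = Suc (2 * y)"
    unfolding y_def by presburger
  then consider "x = 2 * y" | "x = Suc (2 * y)" by blast
  then show ?case
  proof cases
    case 1
    then have "x + 2 * 2 ^ Suc k = 2 * (y + 2 * 2 ^ k)" by simp
    moreover have "rudin_shapiro x = rudin_shapiro y"
      by (simp only: 1 rudin_shapiro_double)
    ultimately show ?thesis by (simp only: rudin_shapiro_double IH)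
  next
    case 2
    then have "x + 2 * 2 ^ Suc k = Suc (2 * (y + 2 * 2 ^ k))" by simp
    moreover have "rudin_shapiro x = (-1) ^ y * rudin_shapiro y"
      by (simp only: 2 rudin_shapiro_double_Suc)
    \<comment> \<open>The sign contributed by the lowest digit survives because the shift of
      \<open>y\<close> is even.\<close>
    moreover have "(-1::int) ^ (y + 2 * 2 ^ k) = (-1) ^ y" by (simp add: power_add)
    ultimately show ?thesis by (simp only: rudin_shapiro_double_Suc IH mult.left_commute)
  qed
qed

section \<open>Density of mismatches between the word and its shift\<close>

lemma rudin_shapiro_mismatch_pair:
  assumes v: "v < p" and p: "p \<le> 2 ^ k"
    and n: "n = 4 * 2 ^ k * i + (2 ^ k - p + v)"
  shows "rudin_shapiro n \<noteq> rudin_shapiro (n + p) \<or>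
    rudin_shapiro (n + 2 * 2 ^ k) \<noteq> rudin_shapiro (n + 2 * 2 ^ k + p)"
proof -
  define q :: nat where "q = 2 ^ k"
  have q: "0 < q" by (simp add: q_def)
  \<comment> \<open>\<open>u\<close> is the place of \<open>n\<close> in its block of length
    \<open>4 * q\<close>, among the last \<open>p\<close> places of the first quarter;
    \<open>n + p\<close> then has place \<open>q + v\<close>, in the second quarter.\<close>
  define u where "u = q - p + v"
  have u: "u < q" using v p by (simp add: u_def q_def)
  have nu: "n = q * (4 * i) + u" "n = (2 * q) * (2 * i) + u" "n = (4 * q) * i + u"
    using n by (simp_all add: u_def q_def)
  have npv: "n + p = q * (4 * i + 1) + v" "n + p = (2 * q) * (2 * i) + (q + v)"
    "n + p = (4 * q) * i + (q + v)"
    using n p by (simp_all add: q_def)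
  have vq: "v < q" using v p by (simp add: q_def)
  have quot: "(b * x + y) div b = x" if "y < b" for b x y :: nat using that by simp
  have dn: "n div q = 4 * i" "n div (2 * q) = 2 * i" "n div (4 * q) = i"
    using u quot[of u q "4 * i"] quot[of u "2 * q" "2 * i"] quot[of u "4 * q" i]
    by (simp_all only: nu[symmetric])
  have dp: "(n + p) div q = 4 * i + 1" "(n + p) div (2 * q) = 2 * i" "(n + p) div (4 * q) = i"
    using vq quot[of v q "4 * i + 1"] quot[of "q + v" "2 * q" "2 * i"] quot[of "q + v" "4 * q" i]
    by (simp_all only: npv[symmetric])
  have "rudin_shapiro (n + 2 * q) = (-1) ^ i * rudin_shapiro n"
    using rudin_shapiro_half_block_shift[of n k] dn by (simp add: q_def power_add power_mult)
  moreover have "rudin_shapiro (n + p + 2 * q) = - ((-1) ^ i * rudin_shapiro (n + p))"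
    using rudin_shapiro_half_block_shift[of "n + p" k] dp
    by (simp add: q_def power_add power_mult)
  \<comment> \<open>Two equalities would force a value of the word to equal its own negative, hence
    to vanish.\<close>
  ultimately show ?thesis
    using rudin_shapiro_nonzero[of n] by (auto simp: q_def ac_simps)
qed

text \<open>Each full block yields \<open>p\<close> mismatches, one from each pair. The additional
  block in \<open>a + 1\<close> pays for aligning the window to a multiple of the block
  length.\<close>

lemma rudin_shapiro_mismatch_count:
  assumes p: "p \<le> 2 ^ k" and a: "4 * 2 ^ k * (a + 1) \<le> L"
  shows "a * p \<le> card {n \<in> {m..<m + L}. rudin_shapiro n \<noteq> rudin_shapiro (n + p)}"
proof -
  define q :: nat where "q = 2 ^ k"
  have q: "0 < q" by (simp add: q_def)
  \<comment> \<open>This is \<open>m / (4 * q)\<close> rounded up: block \<open>c\<close> is the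
    first one starting at or after \<open>m\<close>.\<close>
  define c where "c = (m + 4 * q - 1) div (4 * q)"
  have c: "m \<le> 4 * q * c" "4 * q * c + 1 \<le> m + 4 * q"
  proof -
    have "4 * q * c + (m + 4 * q - 1) mod (4 * q) = m + 4 * q - 1"
      unfolding c_def by (rule mult_div_mod_eq)
    moreover have "(m + 4 * q - 1) mod (4 * q) < 4 * q" using q by simp
    ultimately show "m \<le> 4 * q * c" "4 * q * c + 1 \<le> m + 4 * q" using q by linarith+
  qed
  define base where "base i v = 4 * q * (i + c) + (q - p + v)" for i v
  define g where "g = (\<lambda>(i, v). if rudin_shapiro (base i v) \<noteq> rudin_shapiro (base i v + p)
    then base i v else base i v + 2 * q)"
  let ?M = "{n \<in> {m..<m + L}. rudin_shapiro n \<noteq> rudin_shapiro (n + p)}"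
  have pq: "p \<le> q" using p by (simp add: q_def)
  have ub: "q - p + v < q" if "v < p" for v using that pq by simp
  have bounds: "m \<le> base i v \<and> base i v + 2 * q < m + L" if "i < a" "v < p" for i v
  proof -
    have "4 * q * i + 4 * q \<le> 4 * q * a"
      using mult_le_mono2[of "i + 1" a "4 * q"] that(1) by (simp add: distrib_left)
    moreover have "4 * q * a + 4 * q \<le> L" using a by (simp add: q_def distrib_left)
    ultimately show ?thesis
      using c ub[OF that(2)] by (simp add: base_def distrib_left)
  qed
  have "g ` ({..<a} \<times> {..<p}) \<subseteq> ?M"
  proof (clarsimp)
    fix i v assume iv: "i < a" "v < p"
    show "m \<le> g (i, v) \<and> g (i, v) < m + L \<and> rudin_shapiro (g (i, v)) \<noteq> rudin_shapiro (g (i, v) + p)"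
      using bounds[OF iv] rudin_shapiro_mismatch_pair[OF iv(2) p, of "base i v" "i + c"]
      by (auto simp: g_def base_def q_def)
  qed
  moreover have "inj_on g ({..<a} \<times> {..<p})"
  proof (rule inj_onI, clarsimp)
    \<comment> \<open>Whichever member of the pair \<open>g\<close> selects, the quotient by
      \<open>4 * q\<close> recovers \<open>i\<close> and the remainder modulo \<open>2 * q\<close>
      recovers \<open>v\<close>.\<close>
    have g_div_mod: "g (i, v) div (4 * q) = i + c \<and> g (i, v) mod (2 * q) = q - p + v"
      if v: "v < p" for i v
    proof -
      obtain b where b: "b \<in> {0, 1}" "g (i, v) = (4 * q) * (i + c) + (2 * q * b + (q - p + v))"
        by (cases "g (i, v) = base i v") (auto simp: g_def base_def split: if_splits)
      then have "2 * q * b + (q - p + v) < 4 * q" using ub[OF v] q by auto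
      moreover have "g (i, v) = (2 * q) * (2 * (i + c) + b) + (q - p + v)"
        unfolding b(2) by (simp add: algebra_simps)
      moreover have "q - p + v < 2 * q" using ub[OF v] q by linarith
      ultimately show ?thesis
        using b(2) q by (metis add.right_neutral div_less div_mult_self4 mod_less
            mod_mult_self4 mult_eq_0_iff not_less0 zero_neq_numeral)
    qed
    fix i v i' v' assume "v < p" "v' < p" "g (i, v) = g (i', v')"
    then have "i + c = i' + c" "q - p + v = q - p + v'"
      using g_div_mod[of v i] g_div_mod[of v' i'] by metis+
    then show "i = i' \<and> v = v'" by simp
  qed
  moreover have "finite ?M" by simp
  ultimately have "card ({..<a} \<times> {..<p}) \<le> card ?M"
    by (intro card_inj_on_le)
  then show ?thesis by simp
qed

lemma ex_power_of_two_between: "0 < (p::nat) \<Longrightarrow> \<exists>k. p \<le> 2 ^ k \<and> 2 ^ k < 2 * p"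
proof (induction p rule: nat_induct_non_zero)
  case 1
  show ?case by (rule exI[of _ 0]) simp
next
  case (Suc p)
  then obtain k where k: "p \<le> 2 ^ k" "2 ^ k < 2 * p" by blast
  show ?case
  proof (cases "p = 2 ^ k")
    case True
    with Suc.hyps show ?thesis by (intro exI[of _ "Suc k"]) simp
  next
    case False
    with k show ?thesis by (intro exI[of _ k]) simp
  qed
qed

lemma rudin_shapiro_mismatch_density:
  assumes p: "0 < p" and L: "16 * p \<le> L"
  shows "L < 24 * card {n \<in> {m..<m + L}. rudin_shapiro n \<noteq> rudin_shapiro (n + p)}"
proof -
  obtain k where k: "p \<le> 2 ^ k" "2 ^ k < 2 * p"
    using ex_power_of_two_between[OF p] by blast
  define q :: nat where "q = 2 ^ k"
  define d where "d = L div (4 * q)"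
  have q: "0 < q" "q < 2 * p" using k by (simp_all add: q_def)
  \<comment> \<open>Two blocks fit since \<open>8 * q < 16 * p \<le> L\<close>. One may be lost to
    alignment, and the constant 24 arises from \<open>q < 2 * p\<close> and
    \<open>d + 1 \<le> 3 * (d - 1)\<close>.\<close>
  have d2: "2 \<le> d"
    unfolding d_def using q L by (simp add: less_eq_div_iff_mult_less_eq)
  have dL: "4 * q * d \<le> L" "L < 4 * q * (d + 1)"
    unfolding d_def using q dividend_less_div_times[of "4 * q" L]
    by (simp_all add: distrib_left mult.commute)
  have "4 * 2 ^ k * (d - 1 + 1) \<le> L" using dL d2 by (simp add: q_def)
  then have *: "(d - 1) * p \<le> card {n \<in> {m..<m + L}. rudin_shapiro n \<noteq> rudin_shapiro (n + p)}"
    by (rule rudin_shapiro_mismatch_count[OF k(1)])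
  have "L < 4 * q * (d + 1)" by (rule dL)
  also have "\<dots> \<le> 8 * p * (d + 1)" using q by (intro mult_right_mono) simp_all
  also have "\<dots> \<le> 8 * p * (3 * (d - 1))" using d2 by (intro mult_left_mono) auto
  also have "\<dots> = 24 * ((d - 1) * p)" by simp
  finally show ?thesis using * by linarith
qed

section \<open>From closeness to the bound on the exponent\<close>

lemma length_factor: "length (factor a r s) = nat (s - r + 1)"
  by (simp add: factor_def)

lemma nth_factor: "i < nat (s - r + 1) \<Longrightarrow> factor a r s ! i = a (nat (r + int i))"
  by (simp add: factor_def)

lemma close_words_mismatch_card:
  assumes "close_words \<epsilon> \<delta> U V"
  shows "real (card {i \<in> {..<length U}. U ! i \<noteq> V ! i}) \<le> \<epsilon> * real (length U)"
proof -
  obtain lo hi :: "nat \<Rightarrow> nat" where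
    mism: "{i \<in> {1..length U}. U ! (i - 1) \<noteq> V ! (i - 1)} \<subseteq> (\<Union>j<\<delta>. {lo j..hi j})"
    and le: "real (card (\<Union>j<\<delta>. {lo j..hi j})) \<le> \<epsilon> * real (length U)"
    using assms unfolding close_words_def by blast
  have "card {i \<in> {..<length U}. U ! i \<noteq> V ! i} \<le> card (\<Union>j<\<delta>. {lo j..hi j})"
  \<comment> \<open>\<open>Suc\<close> turns list indices counted from 0 into positions counted from
    1.\<close>
  proof (rule card_inj_on_le[where f = Suc])
    show "Suc ` {i \<in> {..<length U}. U ! i \<noteq> V ! i} \<subseteq> (\<Union>j<\<delta>. {lo j..hi j})"
      using mism by (intro order_trans[OF _ mism]) auto
  qed auto
  with le show ?thesis by linarith
qed

lemma star_condition_rudin_shapiro_le: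
  assumes "star_condition rudin_shapiro \<rho>"
  shows "\<rho> \<le> 25"
proof (rule ccontr)
  assume "\<not> \<rho> \<le> 25"
  then have \<rho>: "25 < \<rho>" by simp
  \<comment> \<open>This closeness parameter is the lower bound for the density of mismatches, which
    is strict.\<close>
  have "(0::real) < 1 / 24" by simp
  then obtain r s t :: "nat \<Rightarrow> int" and \<delta> where
    rst: "\<And>n. -1 \<le> r n \<and> r n < s n \<and> s n < t n"
    and t: "\<And>n. real_of_int (t n) \<ge> \<rho> * real_of_int (s n)"
    and lim: "filterlim (\<lambda>n. s n - r n) at_top sequentially"
    and close: "\<forall>\<^sub>F n in sequentially. close_words (1 / 24) \<delta>
      (factor rudin_shapiro (r n + 1) (r n + t n - s n)) (factor rudin_shapiro (s n + 1) (t n))"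
    using assms unfolding star_condition_def by meson
  \<comment> \<open>As \<open>r n \<ge> -1\<close>, the value 3 gives \<open>s n \<ge> 2\<close>,
    hence \<open>t n - s n \<ge> 24 * s n \<ge> 16 * (s n + 1) \<ge> 16 * (s n - r n)\<close>, the
    window length required by the density bound.\<close>
  have "\<forall>\<^sub>F n in sequentially. 3 \<le> s n - r n"
    using lim by (simp add: filterlim_at_top)
  with close have "\<forall>\<^sub>F n in sequentially. 3 \<le> s n - r n \<and> close_words (1 / 24) \<delta>
      (factor rudin_shapiro (r n + 1) (r n + t n - s n)) (factor rudin_shapiro (s n + 1) (t n))"
    by eventually_elim simp
  then obtain n where n: "3 \<le> s n - r n"
    and cl: "close_words (1 / 24) \<delta>
      (factor rudin_shapiro (r n + 1) (r n + t n - s n)) (factor rudin_shapiro (s n + 1) (t n))"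
    by (auto dest: eventually_happens)
  define m p L where "m = nat (r n + 1)" and "p = nat (s n - r n)" and "L = nat (t n - s n)"
  have m: "int m = r n + 1" and p: "int p = s n - r n" and L: "int L = t n - s n"
    using rst[of n] by (auto simp: m_def p_def L_def)
  have "25 * real_of_int (s n) \<le> \<rho> * real_of_int (s n)"
    using \<rho> rst[of n] by (intro mult_right_mono) auto
  with t[of n] have "25 * s n \<le> t n" by linarith
  with n m p L have pL: "0 < p" "16 * p \<le> L" by linarith+
  let ?U = "factor rudin_shapiro (r n + 1) (r n + t n - s n)"
  let ?V = "factor rudin_shapiro (s n + 1) (t n)"
  have len: "length ?U = L" using L by (simp add: length_factor)
  have U: "?U ! i = rudin_shapiro (m + i)" if "i < L" for i
  proof -
    have "r n + 1 + int i = int (m + i)" using m by simp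
    then show ?thesis using that L by (simp only: nth_factor nat_int)
  qed
  have V: "?V ! i = rudin_shapiro (m + i + p)" if "i < L" for i
  proof -
    have "s n + 1 + int i = int (m + i + p)" using m p by simp
    then show ?thesis using that L by (simp only: nth_factor nat_int)
  qed
  have "{k \<in> {m..<m + L}. rudin_shapiro k \<noteq> rudin_shapiro (k + p)} =
      (+) m ` {i \<in> {..<L}. ?U ! i \<noteq> ?V ! i}" (is "?A = _ ` ?B")
  proof (intro set_eqI iffI)
    fix k assume "k \<in> ?A"
    then show "k \<in> (+) m ` ?B"
      by (intro image_eqI[of _ _ "k - m"]) (auto simp: U V)
  qed (auto simp: U V)
  then have "card ?A = card ?B" by (simp add: card_image)
  moreover have "real (card ?B) \<le> 1 / 24 * real L"
    using close_words_mismatch_card[OF cl] by (simp add: len)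
  moreover have "L < 24 * card ?A"
    by (rule rudin_shapiro_mismatch_density[OF pL])
  ultimately show False by linarith
qed

theorem theorem6p5: "Rdio rudin_shapiro \<le> 25"
  unfolding Rdio_def
  by (intro SUP_least) (auto dest: star_condition_rudin_shapiro_le)

end
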